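(* If a continued fraction $\overline{\alpha}$ has a convergent denominator $q_k$ such that $n\mid q_k$ for $n\in\mathbb{N}$ and $n<q_k$, then $B(n\alpha)\ge n$. Further, if $\frac{p_k}{q_k}=\frac{p_k}{nq'_k}$ is a convergent of $\overline{\alpha}$, then $\frac{p_k}{q'_k}$ is a convergent of $\overline{n\alpha}$.
   Context: For a real number $\alpha$, $\overline{\alpha}=[a_0;a_1,a_2,\dots]$ (finite or infinite) denotes its continued fraction expansion, with $a_0\in\mathbb{Z}$ and partial quotients $a_i\in\mathbb{N}$ for $i\ge1$; $\overline{n\alpha}$ denotes the continued fraction expansion of the real number $n\alpha$. The $k$-th convergent of $\overline{\alpha}$ is $\frac{p_k}{q_k}:=[a_0;a_1,\dots,a_k]$, where $p_{-1}=1,\ p_0=a_0,\ p_k=a_kp_{k-1}+p_{k-2}$ and $q_{-1}=0,\ q_0=1,\ q_k=a_kq_{k-1}+q_{k-2}$; $q_k$ is called the $k$-th convergent denominator and $p_k$ the $k$-th convergent numerator. The height of a real number $x$ is $B(x):=\sup\{a_i : \overline{x}=[a_0;a_1,\dots],\ i\in\mathbb{N}\}$, i.e. the supremum of the partial quotients of $\overline{x}$ excluding the first one, $a_0$.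
   Formalization: For B(nα) ≥ n it is also assumed that p_k/q_k is not the last convergent of a finite expansion (automatic for irrational α); otherwise α = 3/10 = [0;3,3], q_2 = 10, n = 5 gives nα = 3/2 = [1;2] with B = 2 < 5. *)

theory Defs
  imports Complex_Main "HOL-Library.Extended_Nat"
begin

(* Once some complete quotient is an integer the expansion has ended. Later values are
   meaningless (they are 0, because 1 / 0 = 0) and are excluded by cf_indices below. *)
fun cf_complete :: "real \<Rightarrow> nat \<Rightarrow> real" where
  "cf_complete x 0 = x"
| "cf_complete x (Suc i) = 1 / frac (cf_complete x i)"

(* The indices i for which the partial quotient a_i of x exists: all of nat if x is irrational,
   {0..m} if x = [a_0; a_1, ..., a_m]. For rational x this is the Euclidean expansion, i.e. the
   one whose last partial quotient is greater than 1 unless x is an integer. *)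
definition cf_indices :: "real \<Rightarrow> nat set" where
  "cf_indices x = {i. \<forall>j<i. cf_complete x j \<notin> \<int>}"

definition cf_quot :: "real \<Rightarrow> nat \<Rightarrow> int" where
  "cf_quot x i = \<lfloor>cf_complete x i\<rfloor>"

(* The second equations are the recurrences at k = 1 with p_{-1} = 1 and q_{-1} = 0. *)
fun cf_num :: "real \<Rightarrow> nat \<Rightarrow> int" where
  "cf_num x 0 = cf_quot x 0"
| "cf_num x (Suc 0) = cf_quot x 1 * cf_num x 0 + 1"
| "cf_num x (Suc (Suc k)) = cf_quot x (Suc (Suc k)) * cf_num x (Suc k) + cf_num x k"

fun cf_den :: "real \<Rightarrow> nat \<Rightarrow> int" where
  "cf_den x 0 = 1"
| "cf_den x (Suc 0) = cf_quot x 1 * cf_den x 0 + 0"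
| "cf_den x (Suc (Suc k)) = cf_quot x (Suc (Suc k)) * cf_den x (Suc k) + cf_den x k"

(* p / q as a fraction: numerator and denominator both agree with those of a convergent. *)
definition is_convergent :: "real \<Rightarrow> int \<Rightarrow> int \<Rightarrow> bool" where
  "is_convergent x p q \<longleftrightarrow> (\<exists>k\<in>cf_indices x. p = cf_num x k \<and> q = cf_den x k)"

(* The supremum may be infinite; it is 0 for an integer x, where there is no a_i with i > 0.
   The truncation nat loses nothing, since existing a_i with i > 0 are positive. *)
definition cf_height :: "real \<Rightarrow> enat" where
  "cf_height x = (SUP i\<in>{i \<in> cf_indices x. i > 0}. enat (nat (cf_quot x i)))"

end

theory Submission
  imports Defs
begin

text \<open>
  Write \<open>\<alpha> = (p\<^sub>k x + p\<^sub>k\<^sub>-\<^sub>1) / (q\<^sub>k x + q\<^sub>k\<^sub>-\<^sub>1)\<close> with the complete quotient \<open>x > 1\<close>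
  following index \<open>k\<close>. If \<open>q\<^sub>k = n q'\<close>, then for every integer \<open>t\<close>
  \<open>n \<alpha> = (p\<^sub>k \<zeta> + R) / (q' \<zeta> + S)\<close> with \<open>\<zeta> = n x + t\<close>, \<open>S = q\<^sub>k\<^sub>-\<^sub>1 - t q'\<close> and
  \<open>R = n p\<^sub>k\<^sub>-\<^sub>1 - t p\<^sub>k\<close>, and this fractional linear map has determinant \<open>\<plusminus>1\<close>. Choosing
  \<open>t \<ge> 0\<close> such that \<open>0 \<le> S \<le> q'\<close>, the Euclidean algorithm on \<open>p\<^sub>k / q'\<close> shows that
  \<open>p\<^sub>k / q'\<close> is a convergent of \<open>n \<alpha>\<close> followed by the complete quotient \<open>\<zeta> > n\<close>.
\<close>

section \<open>Passing to the tail of an expansion\<close>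

lemma cf_complete_shift: "cf_complete x (Suc i) = cf_complete (1 / frac x) i"
  by (induction i) auto

lemma cf_quot_shift: "cf_quot x (Suc i) = cf_quot (1 / frac x) i"
  by (simp only: cf_quot_def cf_complete_shift)

lemma zero_in_cf_indices: "0 \<in> cf_indices x"
  by (simp add: cf_indices_def)

lemma Suc_in_cf_indices_iff:
  "Suc i \<in> cf_indices x \<longleftrightarrow> i \<in> cf_indices x \<and> cf_complete x i \<notin> \<int>"
  by (auto simp: cf_indices_def less_Suc_eq)

lemma Suc_in_cf_indices_shift:
  "Suc i \<in> cf_indices x \<longleftrightarrow> x \<notin> \<int> \<and> i \<in> cf_indices (1 / frac x)"
  unfolding cf_indices_def mem_Collect_eq
  using All_less_Suc2[of i "\<lambda>j. cf_complete x j \<notin> \<int>"]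
  by (simp only: cf_complete_shift cf_complete.simps(1))

text \<open>Putting a_0 in front of a tail with convergent P / Q gives a_0 + Q / P = (a_0 P + Q) /
  P, so the numerator of the tail becomes the denominator.\<close>

lemma cf_den_shift: "cf_den x (Suc i) = cf_num (1 / frac x) i"
  by (induction i rule: induct_nat_012) (simp_all add: cf_quot_shift)

lemma cf_num_shift:
  "cf_num x (Suc i) = \<lfloor>x\<rfloor> * cf_num (1 / frac x) i + cf_den (1 / frac x) i"
proof (induction i rule: induct_nat_012)
  case 0
  then show ?case by (simp add: cf_quot_shift) (simp add: cf_quot_def)
next
  case 1
  then show ?case
    by (simp add: cf_quot_shift algebra_simps) (simp add: cf_quot_def)
next
  case (ge2 n)
  have "cf_num x (Suc (Suc (Suc n)))
      = cf_quot (1 / frac x) (Suc (Suc n)) * cf_num x (Suc (Suc n)) + cf_num x (Suc n)"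
    by (simp only: cf_num.simps cf_quot_shift)
  then show ?case
    by (simp only: ge2.IH) (simp add: algebra_simps)
qed

section \<open>Positivity and lowest terms\<close>

lemma cf_complete_gt_1:
  assumes "Suc i \<in> cf_indices x"
  shows "cf_complete x (Suc i) > 1"
  using assms frac_lt_1[of "cf_complete x i"] frac_gt_0_iff[of "cf_complete x i"]
  by (simp add: Suc_in_cf_indices_iff)

lemma cf_quot_ge_1: "Suc i \<in> cf_indices x \<Longrightarrow> cf_quot x (Suc i) \<ge> 1"
  using cf_complete_gt_1[of i x] by (simp only: cf_quot_def le_floor_iff) simp

lemma cf_den_ge_1: "i \<in> cf_indices x \<Longrightarrow> cf_den x i \<ge> 1"
proof (induction i rule: induct_nat_012)
  case 1
  then show ?case using cf_quot_ge_1[of 0 x] by simp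
next
  case (ge2 i)
  then have "cf_den x i \<ge> 1" "cf_den x (Suc i) \<ge> 1"
    by (simp_all add: Suc_in_cf_indices_iff)
  moreover have "cf_quot x (Suc (Suc i)) \<ge> 1"
    using ge2.prems by (rule cf_quot_ge_1)
  ultimately have "1 * 1 \<le> cf_quot x (Suc (Suc i)) * cf_den x (Suc i)"
    by (intro mult_mono) auto
  with \<open>cf_den x i \<ge> 1\<close> show ?case by simp
qed auto

text \<open>By the recurrences, raising the index by one only flips the sign of the
  determinant.\<close>

lemma cf_det:
  "cf_num x (Suc m) * cf_den x m - cf_den x (Suc m) * cf_num x m = (- 1) ^ m"
  by (induction m) (simp_all add: algebra_simps)

lemma coprime_cf_num_cf_den: "coprime (cf_num x k) (cf_den x k)"
proof (cases k)
  case (Suc m)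
  show ?thesis
  proof (rule coprimeI)
    fix d assume "d dvd cf_num x k" "d dvd cf_den x k"
    then have "d dvd cf_num x (Suc m) * cf_den x m - cf_den x (Suc m) * cf_num x m"
      unfolding Suc by (intro dvd_diff dvd_mult2)
    then have "d dvd (- 1) ^ m"
      unfolding cf_det .
    then show "is_unit d"
      using dvd_trans by (cases "even m") auto
  qed
qed simp

section \<open>Recovering a number from its convergents\<close>

lemma cf_complete_step:
  assumes "cf_complete x i \<notin> \<int>"
  shows "cf_complete x i * cf_complete x (Suc i) = cf_quot x i * cf_complete x (Suc i) + 1"
  using assms frac_gt_0_iff[of "cf_complete x i"]
  by (simp add: cf_quot_def frac_def field_simps)

text \<open>This is x = (p u + p') / (q u + q') cleared of denominators, with u the complete
  quotient after index \<open>Suc m\<close>. The induction step substitutes u = a + 1 / v and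
  multiplies by v.\<close>

lemma cf_complete_moebius:
  assumes "Suc (Suc m) \<in> cf_indices x"
  shows "x * (cf_den x (Suc m) * cf_complete x (Suc (Suc m)) + cf_den x m)
       = cf_num x (Suc m) * cf_complete x (Suc (Suc m)) + cf_num x m"
  using assms
proof (induction m)
  case 0
  let ?u = "cf_complete x (Suc 0)" and ?v = "cf_complete x (Suc (Suc 0))"
  have 1: "x * ?u = cf_quot x 0 * ?u + 1"
    using 0 cf_complete_step[of x 0] by (simp add: Suc_in_cf_indices_iff)
  have 2: "?u * ?v = cf_quot x (Suc 0) * ?v + 1"
    using 0 cf_complete_step[of x "Suc 0"] by (simp add: Suc_in_cf_indices_iff)
  have "x * (cf_quot x (Suc 0) * ?v + 1) = (x * ?u) * ?v"
    unfolding 2[symmetric] by simp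
  also have "\<dots> = cf_quot x 0 * (?u * ?v) + ?v"
    unfolding 1 by (simp add: algebra_simps)
  also have "\<dots> = cf_quot x 0 * (cf_quot x (Suc 0) * ?v + 1) + ?v"
    unfolding 2 ..
  finally show ?case
    by (simp del: cf_complete.simps add: algebra_simps)
next
  case (Suc m)
  define u v where "u = cf_complete x (Suc (Suc m))" and "v = cf_complete x (Suc (Suc (Suc m)))"
  have IH: "x * (cf_den x (Suc m) * u + cf_den x m) = cf_num x (Suc m) * u + cf_num x m"
    using Suc by (simp add: Suc_in_cf_indices_iff u_def)
  have 2: "u * v = cf_quot x (Suc (Suc m)) * v + 1"
    using Suc.prems cf_complete_step[of x "Suc (Suc m)"]
    unfolding u_def v_def Suc_in_cf_indices_iff[of "Suc (Suc m)"] by blast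
  have "x * (cf_den x (Suc (Suc m)) * v + cf_den x (Suc m))
      = x * (cf_den x (Suc m) * (cf_quot x (Suc (Suc m)) * v + 1) + cf_den x m * v)"
    by (simp add: algebra_simps)
  also have "\<dots> = x * (cf_den x (Suc m) * u + cf_den x m) * v"
    unfolding 2[symmetric] by (simp add: algebra_simps)
  also have "\<dots> = cf_num x (Suc m) * (u * v) + cf_num x m * v"
    unfolding IH by (simp add: algebra_simps)
  also have "\<dots> = cf_num x (Suc (Suc m)) * v + cf_num x (Suc m)"
    unfolding 2 by (simp add: algebra_simps)
  finally show ?case unfolding v_def .
qed

text \<open>Stripping off a_0 reduces the claim to the tail \<open>?z\<close>, which equals its own
  last convergent; \<open>x = \<lfloor>x\<rfloor> + 1 / ?z\<close> carries this back to
  \<open>x\<close>.\<close>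

lemma cf_last_convergent:
  assumes "k \<in> cf_indices x" "Suc k \<notin> cf_indices x"
  shows "x * cf_den x k = cf_num x k"
  using assms
proof (induction k arbitrary: x)
  case 0
  then show ?case
    by (auto simp: Suc_in_cf_indices_iff zero_in_cf_indices cf_quot_def elim: Ints_cases)
next
  case (Suc k)
  let ?z = "1 / frac x"
  have x: "x \<notin> \<int>" and IH: "?z * cf_den ?z k = cf_num ?z k"
    using Suc.prems Suc.IH[of ?z] by (simp_all add: Suc_in_cf_indices_shift del: times_divide_eq_left)
  from x have "frac x > 0" by (simp add: frac_gt_0_iff)
  then have "cf_den ?z k = frac x * cf_num ?z k"
    using IH by (simp add: field_simps)
  moreover have "x = \<lfloor>x\<rfloor> + frac x"
    by (simp add: frac_def)
  ultimately show ?case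
    by (simp only: cf_den_shift cf_num_shift) (simp add: frac_def algebra_simps)
qed

section \<open>Reading convergents off by the Euclidean algorithm\<close>

lemma floor_frac_add_inverse:
  fixes z :: real and a :: int
  assumes "x = a + 1 / z" "z > 1"
  shows "\<lfloor>x\<rfloor> = a" "1 / frac x = z" "x \<notin> \<int>"
proof -
  show fl: "\<lfloor>x\<rfloor> = a"
    using assms by (intro floor_unique) auto
  then have fr: "frac x = 1 / z"
    using assms by (simp add: frac_def)
  then show "1 / frac x = z" by simp
  show "x \<notin> \<int>"
    using fr assms(2) frac_eq_0_iff[of x] by auto
qed

text \<open>The tail of P / Q is Q / (P mod Q), again in lowest terms and with a smaller
  denominator. This serves the case where \<alpha> is rational and equals its convergent of index
  k.\<close>

lemma cf_rational_convergent:
  fixes P Q :: int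
  assumes "Q \<ge> 1" "coprime P Q"
  shows "is_convergent (of_int P / of_int Q) P Q"
  using assms
proof (induction "nat Q" arbitrary: P Q rule: less_induct)
  case less
  show ?case
  proof (cases "Q = 1")
    case True
    then show ?thesis
      unfolding is_convergent_def
      by (intro bexI[of _ 0]) (auto simp: zero_in_cf_indices cf_quot_def)
  next
    case False
    then have Q: "Q \<ge> 2" using less.prems by simp
    define a Q' where "a = P div Q" and "Q' = P mod Q"
    have P: "P = a * Q + Q'" by (simp add: a_def Q'_def)
    have "Q' \<noteq> 0"
      using less.prems Q by (auto simp: Q'_def mod_eq_0_iff_dvd)
    then have Q': "1 \<le> Q'" "Q' < Q"
      using Q pos_mod_bound[of Q P] pos_mod_sign[of Q P] unfolding Q'_def by linarith+
    have "coprime Q Q'"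
      using less.prems Q unfolding Q'_def by (simp add: coprime_commute)
    then have "is_convergent (of_int Q / of_int Q') Q Q'"
      using Q' by (intro less.hyps) auto
    then obtain j where j: "j \<in> cf_indices (of_int Q / of_int Q')"
        "Q = cf_num (of_int Q / of_int Q') j" "Q' = cf_den (of_int Q / of_int Q') j"
      unfolding is_convergent_def by auto
    have "of_int P / of_int Q = of_int a + 1 / (of_int Q / of_int Q' :: real)"
      using Q Q' by (simp add: P field_simps)
    note step = floor_frac_add_inverse[OF this]
    have "of_int Q / of_int Q' > (1 :: real)" using Q' by simp
    note step = step[OF this]
    show ?thesis
      unfolding is_convergent_def
      using j P step
      by (intro bexI[of _ "Suc j"]) (simp_all add: cf_num_shift cf_den_shift Suc_in_cf_indices_shift)
  qed
qed

text \<open>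
  For \<open>Q = 1\<close> both signs of the determinant are compatible with both \<open>S = 0\<close> and \<open>S = 1\<close>, but
  \<open>\<zeta>\<close> is a complete quotient only for one sign each: \<open>S = 0\<close> goes with a convergent of
  index 0, and \<open>S = 1\<close> with one of index 1.
\<close>

lemma cf_convergent_of_moebius:
  fixes P Q R S :: int and \<zeta> :: real
  assumes "Q \<ge> 1" "0 \<le> S" "S \<le> Q" "\<bar>P * S - Q * R\<bar> = 1"
    and "Q = 1 \<longrightarrow> P * S - Q * R = 2 * S - 1" "\<zeta> > 1"
    and "y * (Q * \<zeta> + S) = P * \<zeta> + R"
  shows "\<exists>j. Suc j \<in> cf_indices y \<and> cf_num y j = P \<and> cf_den y j = Q \<and> cf_complete y (Suc j) = \<zeta>"
  using assms
proof (induction "nat Q" arbitrary: P Q R S y rule: less_induct)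
  case less
  note \<zeta> = \<open>\<zeta> > 1\<close>
  show ?case
  proof (cases "Q = 1")
    case True
    with less.prems consider "S = 0" "R = 1" | "S = 1" "R = P - 1"
      by (cases "S = 0"; cases "S = 1") auto
    then show ?thesis
    proof cases
      case 1
      then have "y = P + 1 / \<zeta>"
        using less.prems(7) True \<zeta> by (simp add: field_simps)
      note step = floor_frac_add_inverse[OF this \<zeta>]
      show ?thesis
        using step True
        by (intro exI[of _ 0]) (simp add: Suc_in_cf_indices_iff zero_in_cf_indices cf_quot_def)
    next
      case 2
      \<comment> \<open>The expansion of \<open>y\<close> begins with P - 1 and 1, followed by
        \<zeta>; its convergent of index 1 is P / 1.\<close>
      define z where "z = 1 + 1 / \<zeta>"
      have "z > 1" using \<zeta> by (simp add: z_def)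
      have "y = (P - 1) + 1 / z"
        using less.prems(7) True 2 \<zeta> by (simp add: z_def field_simps)
      then have "y = of_int (P - 1) + 1 / z" by simp
      note step = floor_frac_add_inverse[OF this \<open>z > 1\<close>]
      have "z = of_int 1 + 1 / \<zeta>" by (simp add: z_def)
      note step' = floor_frac_add_inverse[OF this \<zeta>]
      have "cf_complete y (Suc 0) = z" "cf_complete y (Suc (Suc 0)) = \<zeta>"
        using step step' by simp_all
      then show ?thesis
        using step step' True
        by (intro exI[of _ 1])
           (simp del: cf_complete.simps(2)
             add: Suc_in_cf_indices_iff zero_in_cf_indices cf_quot_def)
    qed
  next
    case False
    then have Q: "Q \<ge> 2" using less.prems(1) by simp
    define \<epsilon> where "\<epsilon> = P * S - Q * R"
    have \<epsilon>: "\<epsilon> = 1 \<or> \<epsilon> = - 1" using less.prems(4) unfolding \<epsilon>_def by linarith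
    \<comment> \<open>Either extreme value of \<open>S\<close> would make \<open>Q\<close> divide
      the determinant, which is a unit.\<close>
    have "S \<noteq> 0"
    proof
      assume "S = 0"
      then have "Q dvd \<epsilon>" by (simp add: \<epsilon>_def)
      then have "Q dvd 1" using \<epsilon> by auto
      with Q show False by simp
    qed
    moreover have "S \<noteq> Q"
    proof
      assume "S = Q"
      then have "Q dvd \<epsilon>" by (simp add: \<epsilon>_def)
      then have "Q dvd 1" using \<epsilon> by auto
      with Q show False by simp
    qed
    ultimately have S: "1 \<le> S" "S \<le> Q - 1" using less.prems(2,3) by auto
    \<comment> \<open>One Euclidean step on the column (P, Q), with the same quotient
      \<open>a\<close> used on (R, S). The determinant only changes sign.\<close>
    define a Q' S' where "a = P div Q" and "Q' = P mod Q" and "S' = R - a * S"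
    have P: "P = a * Q + Q'" by (simp add: a_def Q'_def)
    have R: "R = a * S + S'" by (simp add: S'_def)
    have det: "Q * S' = Q' * S - \<epsilon>" by (simp add: \<epsilon>_def P R algebra_simps)
    have "Q' \<noteq> 0"
    proof
      assume "Q' = 0"
      then have "Q dvd \<epsilon>" using det by (metis dvd_minus_iff dvd_triv_left diff_0 mult_zero_left)
      then have "Q dvd 1" using \<epsilon> by auto
      with Q show False by simp
    qed
    then have Q': "1 \<le> Q'" "Q' < Q"
      using Q pos_mod_bound[of Q P] pos_mod_sign[of Q P] unfolding Q'_def by linarith+
    \<comment> \<open>Since \<open>Q * S' = Q' * S - \<epsilon>\<close>, the strict bounds on
      \<open>S\<close> and \<open>Q'\<close> leave room to absorb \<open>\<epsilon>\<close> in each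
      estimate of \<open>S'\<close>.\<close>
    have "1 * 1 \<le> Q' * S" using Q' S by (intro mult_mono) auto
    then have "0 \<le> Q * S'" using det \<epsilon> by auto
    then have S'0: "0 \<le> S'" using Q by (simp add: zero_le_mult_iff)
    have "Q' * S \<le> Q' * (Q - 1)" using Q' S by (intro mult_left_mono) auto
    also have "\<dots> = Q * Q' - Q'" by (simp add: algebra_simps)
    finally have "Q * S' \<le> Q * Q'" using det \<epsilon> Q' by linarith
    then have S'Q': "S' \<le> Q'" using Q by simp
    have "Q' * S \<le> (Q - 1) * S" using Q' S by (intro mult_right_mono) auto
    also have "\<dots> = Q * S - S" by (simp add: algebra_simps)
    finally have "Q * S' \<le> Q * S" using det \<epsilon> S by linarith
    then have S'S: "S' \<le> S" using Q by simp
    \<comment> \<open>This will be the tail of \<open>y\<close>; \<open>Q' < Q\<close> and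
      \<open>S' \<le> S\<close> make it exceed 1.\<close>
    define z where "z = (Q * \<zeta> + S) / (Q' * \<zeta> + S')"
    have pos: "Q' * \<zeta> + S' > 0" using Q' S'0 \<zeta> by (intro add_pos_nonneg) auto
    have pos': "Q * \<zeta> + S > 0" using Q S \<zeta> by (intro add_pos_nonneg) auto
    have "Q' * \<zeta> + S' < Q * \<zeta> + S" using Q' S'S \<zeta> by (intro add_less_le_mono) auto
    then have "z > 1" using pos by (simp add: z_def)
    have "y * (Q * \<zeta> + S) = a * (Q * \<zeta> + S) + (Q' * \<zeta> + S')"
      using less.prems(7) by (simp add: P R algebra_simps)
    then have "y = a + 1 / z"
      using pos pos' by (simp add: z_def field_simps)
    note step = floor_frac_add_inverse[OF this \<open>z > 1\<close>]
    \<comment> \<open>After a Euclidean step the sign is automatic: \<open>S' = 0\<close> forces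
      \<open>S = \<epsilon> = 1\<close>, while \<open>S' = 1\<close> forces \<open>S = Q - 1\<close>
      and \<open>\<epsilon> = - 1\<close>.\<close>
    have one: "Q * S' - Q' * S = 2 * S' - 1" if "Q' = 1"
    proof -
      have "S' = 0 \<or> S' = 1" using that S'0 S'Q' by auto
      then show ?thesis using that det \<epsilon> S by auto
    qed
    have "\<exists>j. Suc j \<in> cf_indices z \<and> cf_num z j = Q \<and> cf_den z j = Q'
        \<and> cf_complete z (Suc j) = \<zeta>"
    proof (rule less.hyps)
      show "nat Q' < nat Q" using Q' by simp
      show "\<bar>Q * S' - Q' * S\<bar> = 1" using det \<epsilon> by auto
      show "z * (Q' * \<zeta> + S') = Q * \<zeta> + S" using pos by (simp add: z_def)
    qed (use Q' S'0 S'Q' one \<zeta> in auto)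
    then obtain j where "Suc j \<in> cf_indices z" "cf_num z j = Q" "cf_den z j = Q'"
        "cf_complete z (Suc j) = \<zeta>"
      by blast
    then have "Suc (Suc j) \<in> cf_indices y" "cf_num y (Suc j) = P" "cf_den y (Suc j) = Q"
        "cf_complete y (Suc (Suc j)) = \<zeta>"
      using step P
      by (simp_all only: Suc_in_cf_indices_shift[of "Suc j"] cf_num_shift cf_den_shift
          cf_complete_shift[of y "Suc j"] simp_thms)
    then show ?thesis by blast
  qed
qed

section \<open>Convergents of the multiple\<close>

text \<open>Serves both claims: the convergent at \<open>j\<close> gives the second, and the floor
  of the next complete quotient, at least \<open>n\<close>, gives the height bound. A denominator of
  at least 2 guarantees that \<open>k\<close> has a predecessor.\<close>

lemma cf_multiple_convergent:
  fixes \<alpha> :: real and n k :: nat and q' :: int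
  assumes k: "Suc k \<in> cf_indices \<alpha>" and den: "cf_den \<alpha> k = int n * q'" and "cf_den \<alpha> k \<ge> 2"
  obtains j where "Suc j \<in> cf_indices (n * \<alpha>)" "cf_num (n * \<alpha>) j = cf_num \<alpha> k"
    "cf_den (n * \<alpha>) j = q'" "cf_complete (n * \<alpha>) (Suc j) > n"
proof -
  obtain m where m: "k = Suc m" using assms(3) by (cases k) auto
  have idx: "Suc m \<in> cf_indices \<alpha>" "m \<in> cf_indices \<alpha>"
    using k by (simp_all add: m Suc_in_cf_indices_iff)
  define x where "x = cf_complete \<alpha> (Suc k)"
  define p p0 q0 where "p = cf_num \<alpha> k" and "p0 = cf_num \<alpha> m" and "q0 = cf_den \<alpha> m"
  have x: "x > 1" unfolding x_def using k by (rule cf_complete_gt_1)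
  have q0: "q0 \<ge> 1" unfolding q0_def using idx(2) by (rule cf_den_ge_1)
  have nq: "int n * q' > 0" using assms(3) den by simp
  then have n: "n \<ge> 1" and q': "q' \<ge> 1" by (auto simp: zero_less_mult_iff)
  define \<epsilon> where "\<epsilon> = p * q0 - int n * q' * p0"
  have \<epsilon>: "\<epsilon> = 1 \<or> \<epsilon> = - 1"
    using cf_det[of \<alpha> m] unfolding \<epsilon>_def p_def q0_def p0_def den[symmetric] m
    by (cases "even m") auto
  \<comment> \<open>For \<open>q' > 1\<close> this makes \<open>S\<close> the remainder of
    \<open>q0\<close> modulo \<open>q'\<close>. For \<open>q' = 1\<close> it makes \<open>S\<close>
    1 or 0 according to the sign of \<open>\<epsilon>\<close>, and \<open>q0 \<ge> 1\<close> keeps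
    \<open>t\<close> nonnegative.\<close>
  define t where "t = (if q' = 1 then q0 - (if \<epsilon> = 1 then 1 else 0) else q0 div q')"
  define S R where "S = q0 - t * q'" and "R = int n * p0 - t * p"
  define \<zeta> where "\<zeta> = n * x + t"
  have t: "t \<ge> 0" using q0 q' by (auto simp: t_def pos_imp_zdiv_nonneg_iff)
  have S: "0 \<le> S" "S \<le> q'"
  proof -
    have "S = q0 mod q'" if "q' \<noteq> 1"
      using that by (simp add: S_def t_def minus_div_mult_eq_mod)
    moreover have "S = 0 \<or> S = 1" if "q' = 1"
      using that by (simp add: S_def t_def)
    ultimately show "0 \<le> S" "S \<le> q'"
      using q' pos_mod_bound[of q' q0] pos_mod_sign[of q' q0] by linarith+
  qed
  have det: "p * S - q' * R = \<epsilon>" by (simp add: S_def R_def \<epsilon>_def algebra_simps)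
  have "real n < n * x" using n x by simp
  then have \<zeta>: "\<zeta> > n" using t by (simp add: \<zeta>_def)
  have "\<alpha> * (cf_den \<alpha> k * x + q0) = p * x + p0"
    using cf_complete_moebius[of m \<alpha>] k unfolding m x_def p_def q0_def p0_def by simp
  then have "n * (\<alpha> * (n * q' * x + q0)) = n * (p * x + p0)"
    by (simp add: den)
  then have y: "n * \<alpha> * (q' * \<zeta> + S) = p * \<zeta> + R"
    by (simp add: \<zeta>_def S_def R_def algebra_simps)
  have "\<exists>j. Suc j \<in> cf_indices (n * \<alpha>) \<and> cf_num (n * \<alpha>) j = p \<and> cf_den (n * \<alpha>) j = q'
      \<and> cf_complete (n * \<alpha>) (Suc j) = \<zeta>"
  proof (rule cf_convergent_of_moebius[OF q' S _ _ _ y])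
    show "\<bar>p * S - q' * R\<bar> = 1" using det \<epsilon> by auto
    show "q' = 1 \<longrightarrow> p * S - q' * R = 2 * S - 1" using det \<epsilon> by (auto simp: S_def t_def)
    show "\<zeta> > 1" using \<zeta> n by linarith
  qed
  then show thesis using that \<zeta> unfolding p_def by blast
qed

text \<open>The first claim needs a partial quotient after index \<open>k\<close>: for \<alpha> =
  1/6, n = 3 and k = 1 the denominator is 6, but 3\<alpha> = 1/2 has height 2.\<close>

theorem proposition2p10:
  fixes \<alpha> :: real and n k :: nat
  assumes "n > 0" and "k \<in> cf_indices \<alpha>"
  shows "(int n dvd cf_den \<alpha> k \<and> int n < cf_den \<alpha> k \<and> Suc k \<in> cf_indices \<alpha>
            \<longrightarrow> cf_height (real n * \<alpha>) \<ge> enat n)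
       \<and> (\<forall>q'. cf_den \<alpha> k = int n * q' \<longrightarrow> is_convergent (real n * \<alpha>) (cf_num \<alpha> k) q')"
proof (intro conjI impI allI)
  assume "int n dvd cf_den \<alpha> k \<and> int n < cf_den \<alpha> k \<and> Suc k \<in> cf_indices \<alpha>"
  then obtain q' where "cf_den \<alpha> k = int n * q'" "cf_den \<alpha> k \<ge> 2" "Suc k \<in> cf_indices \<alpha>"
    using assms(1) by auto
  from cf_multiple_convergent[OF this(3,1,2)]
  obtain j where j: "Suc j \<in> cf_indices (n * \<alpha>)" "cf_complete (n * \<alpha>) (Suc j) > n" .
  have "int n \<le> cf_quot (n * \<alpha>) (Suc j)"
    using j(2) by (simp add: cf_quot_def le_floor_iff del: cf_complete.simps)
  then have "enat n \<le> enat (nat (cf_quot (n * \<alpha>) (Suc j)))"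
    by simp
  also have "\<dots> \<le> cf_height (n * \<alpha>)"
    unfolding cf_height_def using j(1) by (intro SUP_upper) simp
  finally show "cf_height (real n * \<alpha>) \<ge> enat n" .
next
  fix q' assume den: "cf_den \<alpha> k = int n * q'"
  have pos: "cf_den \<alpha> k \<ge> 1" using assms(2) by (rule cf_den_ge_1)
  then have "int n * q' > 0" using den by simp
  then have q': "q' \<ge> 1" by (auto simp: zero_less_mult_iff)
  \<comment> \<open>Denominator 1 forces \<open>n = 1\<close>. If the expansion ends at
    \<open>k\<close>, then \<open>n * \<alpha>\<close> is itself the reduced fraction with
    denominator \<open>q'\<close>.\<close>
  consider "cf_den \<alpha> k = 1" | "cf_den \<alpha> k \<ge> 2" "Suc k \<in> cf_indices \<alpha>" | "Suc k \<notin> cf_indices \<alpha>"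
    using pos by linarith
  then show "is_convergent (real n * \<alpha>) (cf_num \<alpha> k) q'"
  proof cases
    case 1
    then have "n = 1" using den q' assms(1) by (simp add: zmult_eq_1_iff)
    then show ?thesis
      using den assms(2) by (auto simp: is_convergent_def)
  next
    case 2
    then obtain j where "Suc j \<in> cf_indices (n * \<alpha>)" "cf_num (n * \<alpha>) j = cf_num \<alpha> k"
        "cf_den (n * \<alpha>) j = q'"
      using cf_multiple_convergent[OF _ den] by metis
    then show ?thesis
      unfolding is_convergent_def by (metis Suc_in_cf_indices_iff)
  next
    case 3
    then have "\<alpha> * cf_den \<alpha> k = cf_num \<alpha> k"
      using assms(2) by (intro cf_last_convergent)
    then have "n * \<alpha> = cf_num \<alpha> k / q'"
      using q' by (simp add: den field_simps)
    moreover have "coprime (cf_num \<alpha> k) q'"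
      using coprime_cf_num_cf_den[of \<alpha> k] by (simp add: den)
    ultimately show ?thesis
      using cf_rational_convergent[OF q'] by simp
  qed
qed

end
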